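(* Let $k\colon[0,1]^2\to\mathbb{R}_+$ be continuous, nonnegative and symmetric ($k(t,s)=k(s,t)$ for all $t,s\in[0,1]$), and let $f\in C(\mathbb{R},\mathbb{R}_+)$ be nondecreasing on $\mathbb{R}_+$. Let $K$ be the set of nonnegative functions in $C[0,1]$, and let $L\colon C[0,1]\to C[0,1]$ be given by $(Lu)(t)=\int_0^1k(t,s)u(s)\,ds$. Assume that there exists a continuous function $\theta\colon[0,1]\to\mathbb{R}_+$ such that $$k(t,s)\ge\theta(t)\,k(q,s)\quad\text{for all }t,s,q\in[0,1],\qquad\text{and}\qquad|L\theta|_\infty>0 .$$ Let $\lambda_1=r(L)>0$ be the spectral radius of $L$, which is (under this assumption) an eigenvalue of $L$, and let $\varphi_1\in K\setminus\{0\}$ be a corresponding eigenfunction, $L\varphi_1=\lambda_1\varphi_1$. Assume further that $$\lim_{t\searrow0}\frac{f(t)}{t}>\frac1{\lambda_1}\qquad\text{and}\qquad\lim_{t\to\infty}\frac{f(t)}{t}<\frac1{|L1|_\infty},\qquad\text{where }(L1)(t)=\int_0^1k(t,s)\,ds .$$ Let $0<r<R$ be numbers (which exist by the preceding assumption) such that $$f(t)\ge\frac{t}{\lambda_1}\ \text{ for all }t\in[0,\lambda_1r],\qquad f(t)\le\frac{t}{|L1|_\infty}\ \text{ for all }t\ge|L1|_\infty R .$$ Then there exists a positive solution $u^\ast\in K$ of the equation $$u(t)=\int_0^1k(t,s)f(u(s))\,ds,\qquad t\in[0,1],$$ and moreover $$\frac{r}{|\varphi_1|_\infty}(L\varphi_1)(t)\le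 u^\ast(t)\le(LR)(t)\quad\text{for all }t\in[0,1].$$
   Context: $C[0,1]$ is the space of real continuous functions on $[0,1]$ with the supremum norm $|\cdot|_\infty$. "Positive" means belonging to the cone $K$ of nonnegative continuous functions. In $LR$, $R$ denotes the constant function with value $R$, so $(LR)(t)=R\int_0^1k(t,s)\,ds$. *)

theory Defs
  imports "HOL-Analysis.Analysis"
begin

(* A function on [0,1] is represented by a total function on the reals, of which only the
   values on {0..1} matter. Hence equality in C[0,1] is pointwise equality on {0..1}. *)

definition C01 :: "(real \<Rightarrow> 'a::real_normed_vector) set" where
  "C01 = {u. continuous_on {0..1} u}"

definition sup_norm :: "(real \<Rightarrow> 'a::real_normed_vector) \<Rightarrow> real" where
  "sup_norm u = (SUP t\<in>{0..1}. norm (u t))"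

definition pos_cone :: "(real \<Rightarrow> real) set" where
  "pos_cone = {u \<in> C01. \<forall>t\<in>{0..1}. 0 \<le> u t}"

definition integral_op :: "(real \<Rightarrow> real \<Rightarrow> real) \<Rightarrow> (real \<Rightarrow> real) \<Rightarrow> real \<Rightarrow> real" where
  "integral_op k u t = integral {0..1} (\<lambda>s. k t s * u s)"

(* The spectrum of an operator on the real space C[0,1] is, as usual, that of its
   complexification, acting on the complex-valued continuous functions. *)

definition complexify ::
    "((real \<Rightarrow> real) \<Rightarrow> real \<Rightarrow> real) \<Rightarrow> (real \<Rightarrow> complex) \<Rightarrow> real \<Rightarrow> complex" where
  "complexify L u t = Complex (L (\<lambda>s. Re (u s)) t) (L (\<lambda>s. Im (u s)) t)"

(* Bijectivity on C[0,1], with equality understood on {0..1}, and boundedness of the inverse. *)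

definition boundedly_invertible :: "((real \<Rightarrow> complex) \<Rightarrow> real \<Rightarrow> complex) \<Rightarrow> bool" where
  "boundedly_invertible A \<longleftrightarrow>
     (\<forall>v\<in>C01. \<exists>u\<in>C01. (\<forall>t\<in>{0..1}. A u t = v t) \<and>
        (\<forall>w\<in>C01. (\<forall>t\<in>{0..1}. A w t = v t) \<longrightarrow> (\<forall>t\<in>{0..1}. w t = u t))) \<and>
     (\<exists>M. \<forall>u\<in>C01. sup_norm u \<le> M * sup_norm (A u))"

definition op_spectrum :: "((real \<Rightarrow> real) \<Rightarrow> real \<Rightarrow> real) \<Rightarrow> complex set" where
  "op_spectrum L = {z. \<not> boundedly_invertible (\<lambda>u t. z * u t - complexify L u t)}"

definition op_spectral_radius :: "((real \<Rightarrow> real) \<Rightarrow> real \<Rightarrow> real) \<Rightarrow> real" where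
  "op_spectral_radius L = (SUP z\<in>op_spectrum L. cmod z)"

end

theory Submission
  imports Defs
begin

text \<open>
  Write \<open>T u = L (f \<circ> u)\<close>. Since \<open>k\<close> is nonnegative and \<open>f\<close> is nondecreasing on the nonnegative
  reals, \<open>T\<close> is order preserving on the cone, so it is enough to find a lower solution \<open>\<alpha> \<le> T \<alpha>\<close>
  and an upper solution \<open>T \<beta> \<le> \<beta>\<close> with \<open>\<alpha> \<le> \<beta>\<close>, and to iterate \<open>T\<close> from \<open>\<beta>\<close>: the iterates
  decrease, stay above \<open>\<alpha>\<close>, and their pointwise limit is a fixed point by dominated convergence
  (\<open>exists_fixed_point_between_sub_and_supersolution\<close>). The limit is known only to be bounded and measurable
  at first; it is continuous because it equals an integral against a continuous kernel
  (\<open>continuous_on_integral_op\<close>).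

  Both barriers are images under \<open>L\<close>. Let \<open>\<psi> = (r / |\<phi>\<^sub>1|) \<phi>\<^sub>1\<close>, so that \<open>0 \<le> \<psi> \<le> r\<close>, and take
  \<open>\<alpha> = L \<psi> = \<lambda>\<^sub>1 \<psi>\<close>. Its values lie in \<open>[0, \<lambda>\<^sub>1 r]\<close>, hence \<open>f \<circ> \<alpha> \<ge> \<alpha> / \<lambda>\<^sub>1 = \<psi>\<close>, and applying \<open>L\<close>
  gives \<open>T \<alpha> \<ge> \<alpha>\<close>. Take \<open>\<beta> = L R\<close>. Its values are at most \<open>|L1| R\<close>, hence
  \<open>f \<circ> \<beta> \<le> f (|L1| R) \<le> R\<close> by monotonicity, and applying \<open>L\<close> gives \<open>T \<beta> \<le> \<beta>\<close>. Finally
  \<open>\<psi> \<le> r \<le> R\<close> gives \<open>\<alpha> \<le> \<beta>\<close>.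
\<close>

lemma norm_le_sup_norm:
  assumes "u \<in> C01" "t \<in> {0..1}"
  shows "norm (u t) \<le> sup_norm u"
proof -
  have "compact ((\<lambda>t. norm (u t)) ` {0..1})"
    using assms(1) by (intro compact_continuous_image continuous_intros) (auto simp: C01_def)
  then have "bdd_above ((\<lambda>t. norm (u t)) ` {0..1})"
    by (intro bounded_imp_bdd_above compact_imp_bounded)
  then show ?thesis
    unfolding sup_norm_def using assms(2) by (intro cSUP_upper)
qed

lemma continuous_on_kernel_section:
  fixes k :: "real \<Rightarrow> real \<Rightarrow> real"
  assumes "continuous_on ({0..1} \<times> {0..1}) (\<lambda>(t, s). k t s)" "t \<in> {0..1}"
  shows "continuous_on {0..1} (k t)" "continuous_on {0..1} (\<lambda>s. k s t)"
proof -
  have "continuous_on {0..1} ((\<lambda>(t, s). k t s) \<circ> (\<lambda>s. (t, s)))"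
    using assms by (intro continuous_on_compose continuous_intros)
      (auto intro: continuous_on_subset)
  then show "continuous_on {0..1} (k t)" by (simp add: o_def)
  have "continuous_on {0..1} ((\<lambda>(t, s). k t s) \<circ> (\<lambda>s. (s, t)))"
    using assms by (intro continuous_on_compose continuous_intros)
      (auto intro: continuous_on_subset)
  then show "continuous_on {0..1} (\<lambda>s. k s t)" by (simp add: o_def)
qed

lemma kernel_bounded:
  fixes k :: "real \<Rightarrow> real \<Rightarrow> real"
  assumes "continuous_on ({0..1} \<times> {0..1}) (\<lambda>(t, s). k t s)"
  obtains B where "0 \<le> B" "\<And>t s. t \<in> {0..1} \<Longrightarrow> s \<in> {0..1} \<Longrightarrow> \<bar>k t s\<bar> \<le> B"
proof -
  have "bounded ((\<lambda>(t, s). k t s) ` ({0..1} \<times> {0..1}))"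
    using assms by (intro compact_imp_bounded compact_continuous_image compact_Times) auto
  then obtain B where "0 < B" "\<And>y. y \<in> (\<lambda>(t, s). k t s) ` ({0..1} \<times> {0..1}) \<Longrightarrow> norm y \<le> B"
    by (metis bounded_pos)
  then show ?thesis
    by (intro that[of B]) fastforce+
qed

lemma kernel_times_integrable:
  fixes k :: "real \<Rightarrow> real \<Rightarrow> real"
  assumes "continuous_on ({0..1} \<times> {0..1}) (\<lambda>(t, s). k t s)" "g \<in> C01" "t \<in> {0..1}"
  shows "(\<lambda>s. k t s * g s) integrable_on {0..1}"
  using continuous_on_kernel_section(1)[OF assms(1,3)] assms(2)
  by (intro integrable_continuous_real continuous_intros) (auto simp: C01_def)

text \<open>
  The hypotheses on \<open>g\<close> are those that survive a dominated pointwise limit, because the lemma has to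
  supply the continuity of the limit of the monotone iteration. All regularity comes from \<open>k\<close>: as
  \<open>t\<close> varies, the integrands converge pointwise and stay bounded.
\<close>
lemma continuous_on_integral_op:
  fixes k :: "real \<Rightarrow> real \<Rightarrow> real"
  assumes k: "continuous_on ({0..1} \<times> {0..1}) (\<lambda>(t, s). k t s)"
    and int: "\<And>t. t \<in> {0..1} \<Longrightarrow> (\<lambda>s. k t s * g s) integrable_on {0..1}"
    and bound: "\<And>s. s \<in> {0..1} \<Longrightarrow> \<bar>g s\<bar> \<le> M"
  shows "integral_op k g \<in> C01"
  unfolding C01_def mem_Collect_eq continuous_on_sequentially
proof (intro allI ballI impI)
  fix X t assume t: "t \<in> {0..1::real}" and "(\<forall>n. X n \<in> {0..1}) \<and> X \<longlonglongrightarrow> t"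
  then have X: "\<And>n. X n \<in> {0..1}" "X \<longlonglongrightarrow> t" by auto
  obtain B where B: "0 \<le> B" "\<And>t s. t \<in> {0..1} \<Longrightarrow> s \<in> {0..1} \<Longrightarrow> \<bar>k t s\<bar> \<le> B"
    using kernel_bounded[OF k] by metis
  have "(\<lambda>n. integral {0..1} (\<lambda>s. k (X n) s * g s)) \<longlonglongrightarrow> integral {0..1} (\<lambda>s. k t s * g s)"
  proof (rule dominated_convergence(2))
    show "(\<lambda>s. k (X n) s * g s) integrable_on {0..1}" for n
      using int X(1) by blast
    show "(\<lambda>_. B * M) integrable_on {0..1::real}"
      by (rule integrable_const_ivl)
    show "norm (k (X n) s * g s) \<le> B * M" if "s \<in> {0..1}" for n s
      using B X(1) bound that by (auto simp: abs_mult intro!: mult_mono)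
    show "(\<lambda>n. k (X n) s * g s) \<longlonglongrightarrow> k t s * g s" if "s \<in> {0..1}" for s
    proof -
      have "((\<lambda>t. k t s) \<circ> X) \<longlonglongrightarrow> k t s"
        using continuous_on_kernel_section(2)[OF k that] X t
        unfolding continuous_on_sequentially by blast
      then show ?thesis by (auto simp: o_def intro: tendsto_mult_right)
    qed
  qed
  then show "(integral_op k g \<circ> X) \<longlonglongrightarrow> integral_op k g t"
    by (simp add: o_def integral_op_def)
qed

lemma integral_op_in_C01:
  fixes k :: "real \<Rightarrow> real \<Rightarrow> real"
  assumes "continuous_on ({0..1} \<times> {0..1}) (\<lambda>(t, s). k t s)" "g \<in> C01"
  shows "integral_op k g \<in> C01"
  using assms norm_le_sup_norm[OF assms(2)]
  by (intro continuous_on_integral_op[where M = "sup_norm g"] kernel_times_integrable) auto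

lemma integral_op_mono:
  fixes k :: "real \<Rightarrow> real \<Rightarrow> real"
  assumes "continuous_on ({0..1} \<times> {0..1}) (\<lambda>(t, s). k t s)"
    and "\<And>t s. t \<in> {0..1} \<Longrightarrow> s \<in> {0..1} \<Longrightarrow> 0 \<le> k t s"
    and "g \<in> C01" "h \<in> C01" "\<And>s. s \<in> {0..1} \<Longrightarrow> g s \<le> h s" "t \<in> {0..1}"
  shows "integral_op k g t \<le> integral_op k h t"
  unfolding integral_op_def
  using assms by (intro integral_le kernel_times_integrable mult_left_mono) auto

lemma comp_in_C01:
  fixes f u :: "real \<Rightarrow> real"
  assumes "continuous_on UNIV f" "u \<in> C01"
  shows "f \<circ> u \<in> C01"
  using continuous_on_compose2[OF assms(1)] assms(2) by (simp add: C01_def o_def)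

text \<open>
  The iteration starts at the supersolution \<open>\<beta>\<close>. The iterates converge at each point because they
  decrease and are bounded below by \<open>\<alpha>\<close>; nonnegativity of \<open>\<alpha>\<close> keeps them where \<open>f\<close> is monotone.
\<close>
lemma exists_fixed_point_between_sub_and_supersolution:
  fixes k :: "real \<Rightarrow> real \<Rightarrow> real" and f \<alpha> \<beta> :: "real \<Rightarrow> real"
  assumes k: "continuous_on ({0..1} \<times> {0..1}) (\<lambda>(t, s). k t s)"
    and k_nonneg: "\<And>t s. t \<in> {0..1} \<Longrightarrow> s \<in> {0..1} \<Longrightarrow> 0 \<le> k t s"
    and f: "continuous_on UNIV f" and f_mono: "mono_on {0..} f"
    and \<alpha>: "\<alpha> \<in> C01" "\<And>t. t \<in> {0..1} \<Longrightarrow> 0 \<le> \<alpha> t"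
      "\<And>t. t \<in> {0..1} \<Longrightarrow> \<alpha> t \<le> integral_op k (f \<circ> \<alpha>) t"
    and \<beta>: "\<beta> \<in> C01" "\<And>t. t \<in> {0..1} \<Longrightarrow> integral_op k (f \<circ> \<beta>) t \<le> \<beta> t"
    and \<alpha>\<beta>: "\<And>t. t \<in> {0..1} \<Longrightarrow> \<alpha> t \<le> \<beta> t"
  obtains u where "u \<in> C01" "\<And>t. t \<in> {0..1} \<Longrightarrow> u t = integral_op k (f \<circ> u) t"
    "\<And>t. t \<in> {0..1} \<Longrightarrow> \<alpha> t \<le> u t" "\<And>t. t \<in> {0..1} \<Longrightarrow> u t \<le> \<beta> t"
proof -
  define T where "T u = integral_op k (f \<circ> u)" for u
  have T_C01: "T v \<in> C01" if "v \<in> C01" for v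
    unfolding T_def using that by (intro integral_op_in_C01 k comp_in_C01 f)
  have T_mono: "T v t \<le> T w t"
    if "v \<in> C01" "w \<in> C01" "t \<in> {0..1}"
      "\<And>s. s \<in> {0..1} \<Longrightarrow> 0 \<le> v s" "\<And>s. s \<in> {0..1} \<Longrightarrow> v s \<le> w s" for v w t
    unfolding T_def
  proof (intro integral_op_mono[OF k k_nonneg] comp_in_C01 f that(1-3))
    fix s :: real assume s: "s \<in> {0..1}"
    have "0 \<le> v s" "v s \<le> w s" using that(4,5) s by auto
    then show "(f \<circ> v) s \<le> (f \<circ> w) s"
      by (auto intro!: mono_onD[OF f_mono])
  qed auto

  define U where "U n = (T ^^ n) \<beta>" for n
  have U_Suc: "U (Suc n) = T (U n)" for n by (simp add: U_def)
  have U_C01: "U n \<in> C01" for n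
    by (induction n) (auto simp: U_Suc T_C01, simp add: U_def \<beta>(1))
  have \<alpha>_le_U: "\<alpha> t \<le> U n t" if "t \<in> {0..1}" for n t
    using that
  proof (induction n arbitrary: t)
    case 0
    then show ?case using \<alpha>\<beta> by (simp add: U_def)
  next
    case (Suc n)
    have "\<alpha> t \<le> T \<alpha> t" using \<alpha>(3) Suc.prems by (simp add: T_def)
    also have "\<dots> \<le> T (U n) t"
      using \<alpha> U_C01 Suc by (intro T_mono) auto
    finally show ?case by (simp add: U_Suc)
  qed
  have U_nonneg: "0 \<le> U n t" if "t \<in> {0..1}" for n t
    using \<alpha>(2) \<alpha>_le_U that by (meson order_trans)
  have U_step: "U (Suc n) t \<le> U n t" if "t \<in> {0..1}" for n t
    using that
  proof (induction n arbitrary: t)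
    case 0
    then show ?case using \<beta>(2) by (simp add: U_def T_def)
  next
    case (Suc n)
    have "T (U (Suc n)) t \<le> T (U n) t"
      using U_C01 U_nonneg Suc by (intro T_mono) auto
    then show ?case by (simp add: U_Suc)
  qed
  have U_decseq: "decseq (\<lambda>n. U n t)" if "t \<in> {0..1}" for t
    using U_step that by (intro decseq_SucI)
  have U_le_\<beta>: "U n t \<le> \<beta> t" if "t \<in> {0..1}" for n t
    using decseqD[OF U_decseq[OF that], of 0 n] by (simp add: U_def)

  define u where "u t = lim (\<lambda>n. U n t)" for t
  have U_lim: "(\<lambda>n. U n t) \<longlonglongrightarrow> u t" if t: "t \<in> {0..1}" for t
  proof -
    have "\<And>n. \<alpha> t \<le> U n t" using \<alpha>_le_U t by blast
    then obtain l where "(\<lambda>n. U n t) \<longlonglongrightarrow> l"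
      using decseq_convergent[OF U_decseq[OF t]] by metis
    then show ?thesis unfolding u_def by (metis limI)
  qed
  have \<alpha>_le_u: "\<alpha> t \<le> u t" if "t \<in> {0..1}" for t
    by (rule LIMSEQ_le_const[OF U_lim[OF that]]) (use \<alpha>_le_U that in auto)
  have u_le_\<beta>: "u t \<le> \<beta> t" if "t \<in> {0..1}" for t
    by (rule LIMSEQ_le_const2[OF U_lim[OF that]]) (use U_le_\<beta> that in auto)

  obtain B where B: "0 \<le> B" "\<And>t s. t \<in> {0..1} \<Longrightarrow> s \<in> {0..1} \<Longrightarrow> \<bar>k t s\<bar> \<le> B"
    using kernel_bounded[OF k] by metis
  define b where "b = sup_norm \<beta>"
  have \<beta>_le: "\<beta> s \<le> b" if "s \<in> {0..1}" for s
    using norm_le_sup_norm[OF \<beta>(1) that] by (simp add: b_def)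
  define M where "M = \<bar>f 0\<bar> + \<bar>f b\<bar>"
  \<comment> \<open>All iterates and their limit take values in \<open>[0, b]\<close>, on which monotonicity bounds \<open>f\<close> by its
      values at the end points.\<close>
  have f_bound: "\<bar>f x\<bar> \<le> M" if "0 \<le> x" "x \<le> b" for x
    using mono_onD[OF f_mono, of 0 x] mono_onD[OF f_mono, of x b] that by (auto simp: M_def)
  have fU_bound: "\<bar>f (U n s)\<bar> \<le> M" if "s \<in> {0..1}" for n s
    using U_nonneg[OF that] U_le_\<beta>[OF that] \<beta>_le[OF that] by (meson f_bound order_trans)
  have fu_bound: "\<bar>f (u s)\<bar> \<le> M" if "s \<in> {0..1}" for s
    using \<alpha>(2)[OF that] \<alpha>_le_u[OF that] u_le_\<beta>[OF that] \<beta>_le[OF that]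
    by (meson f_bound order_trans)

  have fu_int: "(\<lambda>s. k t s * (f \<circ> u) s) integrable_on {0..1}" (is ?int)
    and TU_lim: "(\<lambda>n. T (U n) t) \<longlonglongrightarrow> T u t" (is ?lim) if t: "t \<in> {0..1}" for t
  proof -
    have 1: "(\<lambda>s. k t s * (f \<circ> U n) s) integrable_on {0..1}" for n
      using t by (intro kernel_times_integrable k comp_in_C01 f U_C01)
    have 2: "(\<lambda>_. B * M) integrable_on {0..1::real}"
      by (rule integrable_const_ivl)
    have 3: "norm (k t s * (f \<circ> U n) s) \<le> B * M" if "s \<in> {0..1}" for n s
      using B t fU_bound that by (auto simp: abs_mult intro!: mult_mono)
    have 4: "(\<lambda>n. k t s * (f \<circ> U n) s) \<longlonglongrightarrow> k t s * (f \<circ> u) s" if "s \<in> {0..1}" for s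
      using continuous_on_tendsto_compose[OF f U_lim[OF that]]
      by (auto simp: o_def intro: tendsto_mult_left)
    show ?int by (rule dominated_convergence(1)[OF 1 2 3 4])
    show ?lim unfolding T_def integral_op_def
      by (rule dominated_convergence(2)[OF 1 2 3 4])
  qed
  have u_eq: "u t = T u t" if "t \<in> {0..1}" for t
  proof -
    have "(\<lambda>n. U (Suc n) t) \<longlonglongrightarrow> u t" by (rule LIMSEQ_Suc[OF U_lim[OF that]])
    then show ?thesis
      using LIMSEQ_unique TU_lim[OF that] unfolding U_Suc by blast
  qed
  have "T u \<in> C01"
    unfolding T_def by (rule continuous_on_integral_op[OF k fu_int]) (use fu_bound in auto)
  then have "u \<in> C01"
    using continuous_on_cong[of "{0..1}" "{0..1}" u "T u"] u_eq by (simp add: C01_def)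
  then show ?thesis
    using that u_eq \<alpha>_le_u u_le_\<beta> unfolding T_def by blast
qed

theorem theorem8:
  fixes k :: "real \<Rightarrow> real \<Rightarrow> real" and f \<theta> \<phi>\<^sub>1 :: "real \<Rightarrow> real"
    and lam\<^sub>1 r R :: real and l_0 l_inf :: ereal
  assumes k_cont: "continuous_on ({0..1} \<times> {0..1}) (\<lambda>(t, s). k t s)"
    and k_nonneg: "\<And>t s. t \<in> {0..1} \<Longrightarrow> s \<in> {0..1} \<Longrightarrow> 0 \<le> k t s"
    and k_sym: "\<And>t s. t \<in> {0..1} \<Longrightarrow> s \<in> {0..1} \<Longrightarrow> k t s = k s t"
    and f_cont: "continuous_on UNIV f"
    and f_nonneg: "\<And>x. 0 \<le> f x"
    and f_mono: "mono_on {0..} f"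
    and \<theta>_cont: "continuous_on {0..1} \<theta>"
    and \<theta>_nonneg: "\<And>t. t \<in> {0..1} \<Longrightarrow> 0 \<le> \<theta> t"
    and k_ge: "\<And>t s q. t \<in> {0..1} \<Longrightarrow> s \<in> {0..1} \<Longrightarrow> q \<in> {0..1} \<Longrightarrow> \<theta> t * k q s \<le> k t s"
    and L\<theta>: "sup_norm (integral_op k \<theta>) > 0"
    and lam\<^sub>1: "lam\<^sub>1 = op_spectral_radius (integral_op k)" "lam\<^sub>1 > 0"
    and \<phi>\<^sub>1_cone: "\<phi>\<^sub>1 \<in> pos_cone" and \<phi>\<^sub>1_nonzero: "\<exists>t\<in>{0..1}. \<phi>\<^sub>1 t \<noteq> 0"
    and \<phi>\<^sub>1_eigen: "\<And>t. t \<in> {0..1} \<Longrightarrow> integral_op k \<phi>\<^sub>1 t = lam\<^sub>1 * \<phi>\<^sub>1 t"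
    and lim_0: "((\<lambda>t. ereal (f t / t)) \<longlongrightarrow> l_0) (at_right 0)" "l_0 > ereal (1 / lam\<^sub>1)"
    and lim_infinity: "((\<lambda>t. ereal (f t / t)) \<longlongrightarrow> l_inf) at_top"
      "l_inf < ereal (1 / sup_norm (integral_op k (\<lambda>_. 1)))"
    and rR: "0 < r" "r < R"
    and f_ge: "\<And>t. 0 \<le> t \<Longrightarrow> t \<le> lam\<^sub>1 * r \<Longrightarrow> f t \<ge> t / lam\<^sub>1"
    and f_le: "\<And>t. t \<ge> sup_norm (integral_op k (\<lambda>_. 1)) * R \<Longrightarrow> f t \<le> t / sup_norm (integral_op k (\<lambda>_. 1))"
  shows "\<exists>u\<in>pos_cone.
           (\<forall>t\<in>{0..1}. u t = integral {0..1} (\<lambda>s. k t s * f (u s))) \<and>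
           (\<forall>t\<in>{0..1}. r / sup_norm \<phi>\<^sub>1 * integral_op k \<phi>\<^sub>1 t \<le> u t \<and> u t \<le> integral_op k (\<lambda>_. R) t)"
proof -
  define N where "N = sup_norm (integral_op k (\<lambda>_. 1))"
  define \<psi> where "\<psi> t = r / sup_norm \<phi>\<^sub>1 * \<phi>\<^sub>1 t" for t
  define \<alpha> where "\<alpha> = integral_op k \<psi>"
  define \<beta> where "\<beta> = integral_op k (\<lambda>_. R)"
  note L_C01 = integral_op_in_C01[OF k_cont] and L_mono = integral_op_mono[OF k_cont k_nonneg]
  have const: "(\<lambda>_. c) \<in> C01" for c :: real by (simp add: C01_def)
  have \<phi>: "\<phi>\<^sub>1 \<in> C01" "\<And>t. t \<in> {0..1} \<Longrightarrow> 0 \<le> \<phi>\<^sub>1 t"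
    using \<phi>\<^sub>1_cone by (auto simp: pos_cone_def)
  have \<phi>_le: "\<phi>\<^sub>1 t \<le> sup_norm \<phi>\<^sub>1" if "t \<in> {0..1}" for t
    using norm_le_sup_norm[OF \<phi>(1) that] by simp
  obtain t\<^sub>0 where t\<^sub>0: "t\<^sub>0 \<in> {0..1}" "0 < \<phi>\<^sub>1 t\<^sub>0"
    using \<phi>\<^sub>1_nonzero \<phi>(2) by (metis order_le_less)
  then have norm_pos: "0 < sup_norm \<phi>\<^sub>1" using \<phi>_le by fastforce
  have \<psi>_C01: "\<psi> \<in> C01"
    using \<phi>(1) norm_pos by (auto simp: C01_def \<psi>_def[abs_def] intro!: continuous_intros)
  have \<psi>_nonneg: "0 \<le> \<psi> t" and \<psi>_le: "\<psi> t \<le> r" if "t \<in> {0..1}" for t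
    using \<phi>(2)[OF that] \<phi>_le[OF that] norm_pos rR(1) by (auto simp: \<psi>_def field_simps)
  have \<alpha>_eq: "\<alpha> t = r / sup_norm \<phi>\<^sub>1 * integral_op k \<phi>\<^sub>1 t" for t
    unfolding \<alpha>_def \<psi>_def integral_op_def by (simp add: mult.left_commute flip: integral_mult_right)
  have \<alpha>_\<psi>: "\<alpha> t = lam\<^sub>1 * \<psi> t" if "t \<in> {0..1}" for t
    using \<phi>\<^sub>1_eigen[OF that] by (simp add: \<alpha>_eq \<psi>_def)
  have \<beta>_eq: "\<beta> t = integral_op k (\<lambda>_. 1) t * R" for t
    unfolding \<beta>_def integral_op_def by simp
  have L1_le: "integral_op k (\<lambda>_. 1) t \<le> N" if "t \<in> {0..1}" for t
    using norm_le_sup_norm[OF L_C01[OF const[of 1]] that] by (simp add: N_def)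
  have \<beta>_le: "\<beta> t \<le> N * R" if "t \<in> {0..1}" for t
    using L1_le[OF that] rR by (simp add: \<beta>_eq)
  have \<alpha>_le_\<beta>: "\<alpha> t \<le> \<beta> t" if "t \<in> {0..1}" for t
    unfolding \<alpha>_def \<beta>_def using \<psi>_le rR(2) that
    by (intro L_mono \<psi>_C01 const) (auto intro: order_trans less_imp_le)
  have \<alpha>_nonneg: "0 \<le> \<alpha> t" if "t \<in> {0..1}" for t
    using \<alpha>_\<psi> \<psi>_nonneg lam\<^sub>1(2) that by simp
  have \<beta>_nonneg: "0 \<le> \<beta> t" if "t \<in> {0..1}" for t
    using \<alpha>_nonneg[OF that] \<alpha>_le_\<beta>[OF that] by simp
  \<comment> \<open>The bound on \<open>f\<close> at \<open>N R\<close> involves a division by \<open>N\<close>; positivity follows by evaluating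
      the barriers where \<open>\<phi>\<^sub>1\<close> is positive.\<close>
  have "0 < \<alpha> t\<^sub>0"
    using t\<^sub>0 lam\<^sub>1(2) rR(1) norm_pos by (simp add: \<alpha>_\<psi> \<psi>_def)
  then have "0 < N * R" using \<alpha>_le_\<beta> \<beta>_le t\<^sub>0(1) by fastforce
  then have N_pos: "0 < N" using rR by (simp add: zero_less_mult_iff)
  have f\<alpha>: "\<psi> t \<le> f (\<alpha> t)" if "t \<in> {0..1}" for t
    using f_ge[of "\<alpha> t"] \<alpha>_\<psi>[OF that] \<alpha>_nonneg[OF that] \<psi>_le[OF that] lam\<^sub>1(2) by simp
  have f\<beta>: "f (\<beta> t) \<le> R" if "t \<in> {0..1}" for t
  proof -
    have "f (\<beta> t) \<le> f (N * R)"
      using \<beta>_le[OF that] \<beta>_nonneg[OF that] by (intro mono_onD[OF f_mono]) auto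
    also have "\<dots> \<le> R" using f_le[of "N * R"] N_pos by (simp add: N_def)
    finally show ?thesis .
  qed
  have \<alpha>_C01: "\<alpha> \<in> C01" and \<beta>_C01: "\<beta> \<in> C01"
    by (simp_all add: \<alpha>_def \<beta>_def L_C01 \<psi>_C01 const)
  have sub: "\<alpha> t \<le> integral_op k (f \<circ> \<alpha>) t" if "t \<in> {0..1}" for t
    by (subst \<alpha>_def, intro L_mono \<psi>_C01 comp_in_C01 f_cont \<alpha>_C01) (use f\<alpha> that in auto)
  have super: "integral_op k (f \<circ> \<beta>) t \<le> \<beta> t" if "t \<in> {0..1}" for t
    by (subst (2) \<beta>_def, intro L_mono const comp_in_C01 f_cont \<beta>_C01) (use f\<beta> that in auto)
  obtain u where u: "u \<in> C01" "\<And>t. t \<in> {0..1} \<Longrightarrow> u t = integral_op k (f \<circ> u) t"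
    "\<And>t. t \<in> {0..1} \<Longrightarrow> \<alpha> t \<le> u t" "\<And>t. t \<in> {0..1} \<Longrightarrow> u t \<le> \<beta> t"
    using exists_fixed_point_between_sub_and_supersolution[OF k_cont k_nonneg f_cont f_mono
        \<alpha>_C01 \<alpha>_nonneg sub \<beta>_C01 super \<alpha>_le_\<beta>]
    by blast
  show ?thesis
  proof (intro bexI[of _ u] conjI ballI)
    show "u \<in> pos_cone"
      using u(1,3) \<alpha>_nonneg by (force simp: pos_cone_def)
    show "u t = integral {0..1} (\<lambda>s. k t s * f (u s))" if "t \<in> {0..1}" for t
      using u(2)[OF that] by (simp add: integral_op_def)
    show "r / sup_norm \<phi>\<^sub>1 * integral_op k \<phi>\<^sub>1 t \<le> u t" if "t \<in> {0..1}" for t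
      using u(3)[OF that] by (simp add: \<alpha>_eq)
    show "u t \<le> integral_op k (\<lambda>_. R) t" if "t \<in> {0..1}" for t
      using u(4)[OF that] by (simp add: \<beta>_def)
  qed
qed

end
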